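(* Let $M$ be a loopless matroid of rank $n$ on a finite set $E$, let $R\subseteq E$ and $Q=E\setminus R$. Suppose that there are positive integers $r,q\ge 1$ such that $|\overline{x}\cap R|\, r=|\overline{x}\cap Q|\, q$ for all $x\in E$. Then $\widetilde{N}_k^2=\widetilde{N}_{k-1}\widetilde{N}_{k+1}$ for all $k\in\{1,\dots,n-1\}$. In particular, $\widetilde{N}_k=\frac{q}{r}\widetilde{N}_{k-1}$ for all $k\in\{1,\dots,n\}$.
   Context: For $0\le k\le n$, $N_k$ is the number of bases of $M$ with exactly $k$ elements in $R$, and $\widetilde{N}_k=N_k/\binom{n}{k}$. For $x\in E$, $\overline{x}$ denotes the closure of $\{x\}$ in $M$ (since $M$ is loopless, this is the parallel class of $x$). *)

theory Defs
  imports Complex_Main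
begin

locale matroid =
  fixes E :: "'a set" and indep :: "'a set \<Rightarrow> bool"
  assumes finite_ground: "finite E"
    and indep_subset_ground: "indep X \<Longrightarrow> X \<subseteq> E"
    and indep_empty: "indep {}"
    and indep_subset: "indep X \<Longrightarrow> Y \<subseteq> X \<Longrightarrow> indep Y"
    and indep_augment: "indep X \<Longrightarrow> indep Y \<Longrightarrow> card X < card Y \<Longrightarrow>
      \<exists>y\<in>Y - X. indep (insert y X)"

definition matroid_basis :: "('a set \<Rightarrow> bool) \<Rightarrow> 'a set \<Rightarrow> bool" where
  "matroid_basis indep B \<longleftrightarrow> indep B \<and> (\<forall>X. indep X \<longrightarrow> B \<subseteq> X \<longrightarrow> X = B)"

definition matroid_rank :: "('a set \<Rightarrow> bool) \<Rightarrow> 'a set \<Rightarrow> nat" where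
  "matroid_rank indep A = Max (card ` {X. X \<subseteq> A \<and> indep X})"

definition matroid_closure :: "'a set \<Rightarrow> ('a set \<Rightarrow> bool) \<Rightarrow> 'a set \<Rightarrow> 'a set" where
  "matroid_closure E indep A =
    {x \<in> E. matroid_rank indep (insert x A) = matroid_rank indep A}"

definition matroid_loop :: "'a set \<Rightarrow> ('a set \<Rightarrow> bool) \<Rightarrow> 'a \<Rightarrow> bool" where
  "matroid_loop E indep x \<longleftrightarrow> x \<in> E \<and> \<not> indep {x}"

definition loopless :: "'a set \<Rightarrow> ('a set \<Rightarrow> bool) \<Rightarrow> bool" where
  "loopless E indep \<longleftrightarrow> (\<forall>x. \<not> matroid_loop E indep x)"

definition num_bases :: "('a set \<Rightarrow> bool) \<Rightarrow> 'a set \<Rightarrow> nat \<Rightarrow> nat" where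
  "num_bases indep R k = card {B. matroid_basis indep B \<and> card (B \<inter> R) = k}"

text \<open>In \<open>norm_num_bases E indep R k\<close> the argument \<open>k\<close> is meant to be at most the rank of the
  matroid; beyond the rank the denominator is \<open>0\<close>.\<close>

definition norm_num_bases :: "'a set \<Rightarrow> ('a set \<Rightarrow> bool) \<Rightarrow> 'a set \<Rightarrow> nat \<Rightarrow> real" where
  "norm_num_bases E indep R k =
    real (num_bases indep R k) / real (matroid_rank indep E choose k)"

end

(* Replacing an element x of a basis by a parallel element y yields a basis. Count the triples
   (B, x, y), where B is a basis with k elements in R, x is in B and R, and y is in Q and parallel
   to x, with weight 1 / |class of x|. The elements of Q form the fraction r / (r + q) of every
   parallel class, so the total weight is N_k * k * r / (r + q). The exchange of x and y identifies
   these triples with those based on bases with k - 1 elements in R, and the total weight is also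
   N_(k-1) * (n - k + 1) * q / (r + q). *)

theory Submission
  imports Defs
begin

lemma card_split:
  assumes "finite A" "A \<subseteq> S \<union> T" "S \<inter> T = {}"
  shows "card A = card (A \<inter> S) + card (A \<inter> T)"
proof -
  have "A = (A \<inter> S) \<union> (A \<inter> T)" using assms(2) by blast
  then show ?thesis using card_Un_disjoint[of "A \<inter> S" "A \<inter> T"] assms by auto
qed

context matroid
begin

section \<open>Rank, extension of independent sets, and bases\<close>

lemma indep_finite: "indep X \<Longrightarrow> finite X"
  using indep_subset_ground finite_ground finite_subset by blast

lemma rank_geI:
  assumes "finite A" "X \<subseteq> A" "indep X"
  shows "card X \<le> matroid_rank indep A"
  unfolding matroid_rank_def using assms by (intro Max_ge) auto

lemma rank_witness:
  assumes "finite A"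
  obtains X where "X \<subseteq> A" "indep X" "card X = matroid_rank indep A"
proof -
  have "matroid_rank indep A \<in> card ` {X. X \<subseteq> A \<and> indep X}"
    unfolding matroid_rank_def using assms indep_empty by (intro Max_in) auto
  then show thesis using that by auto
qed

text \<open>Repeated augmentation of \<open>X\<close> from \<open>Y\<close> stops only when the size
  of \<open>Y\<close> is reached. The bound \<open>Z \<subseteq> X \<union> Y\<close> later pins
  down the extended set exactly.\<close>

lemma indep_extend:
  assumes "indep X" "indep Y" "card X \<le> card Y"
  shows "\<exists>Z. X \<subseteq> Z \<and> Z \<subseteq> X \<union> Y \<and> indep Z \<and> card Z = card Y"
  using assms
proof (induction "card Y - card X" arbitrary: X)
  case 0
  then show ?case by (intro exI[of _ X]) auto
next
  case (Suc d)
  then have "card X < card Y" by simp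
  then obtain y where y: "y \<in> Y - X" "indep (insert y X)"
    using indep_augment[OF Suc.prems(1,2)] by blast
  have "card (insert y X) = Suc (card X)"
    using y indep_finite[OF Suc.prems(1)] by simp
  then have "d = card Y - card (insert y X)" "card (insert y X) \<le> card Y"
    using Suc.hyps(2) by auto
  then obtain Z where "insert y X \<subseteq> Z" "Z \<subseteq> insert y X \<union> Y" "indep Z" "card Z = card Y"
    using Suc.hyps(1)[OF _ y(2) Suc.prems(2)] by blast
  then show ?case using y(1) by blast
qed

text \<open>A maximal independent set smaller than a maximum one could be extended, and an
  independent superset of a set of full rank has no room for further elements. From here on bases
  are recognized by size.\<close>

lemma basis_iff_card:
  "matroid_basis indep B \<longleftrightarrow> indep B \<and> card B = matroid_rank indep E"
proof
  assume B: "matroid_basis indep B"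
  obtain X where X: "indep X" "card X = matroid_rank indep E"
    using rank_witness[OF finite_ground] .
  have "indep B" using B by (simp add: matroid_basis_def)
  moreover have "card B \<le> card X"
    using rank_geI[OF finite_ground indep_subset_ground] \<open>indep B\<close> X by auto
  ultimately obtain Z where "B \<subseteq> Z" "indep Z" "card Z = card X"
    using indep_extend[of B X] X by blast
  then show "indep B \<and> card B = matroid_rank indep E"
    using B X by (auto simp: matroid_basis_def)
next
  assume B: "indep B \<and> card B = matroid_rank indep E"
  have "X = B" if "indep X" "B \<subseteq> X" for X
    using rank_geI[OF finite_ground indep_subset_ground, of X] that B
      card_seteq[OF indep_finite[of X], of B] by auto
  then show "matroid_basis indep B" using B by (auto simp: matroid_basis_def)
qed

lemma finite_bases: "finite {B. matroid_basis indep B}"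
  by (rule finite_subset[of _ "Pow E"])
    (auto simp: matroid_basis_def finite_ground dest: indep_subset_ground)

section \<open>Parallel classes and basis exchange\<close>

lemma indep_singleton: "loopless E indep \<Longrightarrow> x \<in> E \<Longrightarrow> indep {x}"
  by (auto simp: loopless_def matroid_loop_def)

lemma rank_indep:
  assumes "indep A"
  shows "matroid_rank indep A = card A"
proof -
  obtain X where "X \<subseteq> A" "card X = matroid_rank indep A"
    using rank_witness[OF indep_finite[OF assms]] .
  then show ?thesis
    using card_mono[OF indep_finite[OF assms], of X] rank_geI[OF indep_finite[OF assms], of A]
      assms by auto
qed

text \<open>Without loops \<open>{x}\<close> has rank 1, so \<open>y\<close> lies in its closure
  exactly when adding \<open>y\<close> leaves the rank at 1. This reduces closures to dependent
  pairs.\<close>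

lemma in_closure_singleton_iff:
  assumes "loopless E indep" "x \<in> E"
  shows "y \<in> matroid_closure E indep {x} \<longleftrightarrow> y \<in> E \<and> (y = x \<or> \<not> indep {x, y})"
proof -
  have x: "matroid_rank indep {x} = 1"
    using rank_indep[OF indep_singleton[OF assms]] by simp
  have dep: "matroid_rank indep {y, x} = 1" if "\<not> indep {x, y}"
  proof -
    obtain X where X: "X \<subseteq> {y, x}" "indep X" "card X = matroid_rank indep {y, x}"
      using rank_witness[of "{y, x}"] by auto
    have "X \<noteq> {y, x}" using X(2) that by (auto simp: insert_commute)
    then have "X \<subset> {y, x}" using X(1) by blast
    moreover have "card {y, x} \<le> 2" by (simp add: card_insert_if)
    ultimately have "card X \<le> 1" using psubset_card_mono[of "{y, x}" X] by auto
    moreover have "1 \<le> matroid_rank indep {y, x}"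
      using rank_geI[of "{y, x}" "{x}"] indep_singleton[OF assms] by auto
    ultimately show ?thesis using X(3) by simp
  qed
  have ind: "matroid_rank indep {y, x} = 2" if "indep {x, y}" "y \<noteq> x"
    using rank_indep[OF that(1)] that(2) by (simp add: insert_commute card_insert_if)
  show ?thesis unfolding matroid_closure_def using x dep ind by force
qed

lemma closure_singleton_refl: "x \<in> E \<Longrightarrow> x \<in> matroid_closure E indep {x}"
  by (simp add: matroid_closure_def)

lemma closure_singleton_sym:
  assumes "loopless E indep" "x \<in> E" "y \<in> matroid_closure E indep {x}"
  shows "x \<in> matroid_closure E indep {y}"
  using assms in_closure_singleton_iff[of x y] in_closure_singleton_iff[of y x]
  by (auto simp: insert_commute)

text \<open>If \<open>{x, z}\<close> were an independent pair, augmenting \<open>{y}\<close> from it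
  would make \<open>y\<close> independent of \<open>x\<close> or of \<open>z\<close>, although
  \<open>y\<close> is parallel to both.\<close>

lemma closure_singleton_trans:
  assumes "loopless E indep" "x \<in> E"
    and y: "y \<in> matroid_closure E indep {x}" and z: "z \<in> matroid_closure E indep {y}"
  shows "z \<in> matroid_closure E indep {x}"
proof (rule ccontr)
  assume "z \<notin> matroid_closure E indep {x}"
  moreover have "y \<in> E" "z \<in> E" using y z by (auto simp: matroid_closure_def)
  ultimately have xz: "indep {x, z}" "z \<noteq> x"
    using in_closure_singleton_iff[OF assms(1,2), of z] by auto
  moreover have "indep {y}" using indep_singleton assms(1) \<open>y \<in> E\<close> by blast
  ultimately obtain w where "w \<in> {x, z} - {y}" "indep {w, y}"
    using indep_augment[of "{y}" "{x, z}"] by (auto simp: card_insert_if)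
  then show False
    using in_closure_singleton_iff[OF assms(1,2), of y]
      in_closure_singleton_iff[OF assms(1) \<open>y \<in> E\<close>, of z] y z
    by (auto simp: insert_commute)
qed

lemma closure_singleton_eq:
  assumes "loopless E indep" "x \<in> E" "y \<in> matroid_closure E indep {x}"
  shows "matroid_closure E indep {y} = matroid_closure E indep {x}"
proof -
  have "y \<in> E" using assms(3) by (simp add: matroid_closure_def)
  then show ?thesis
    using closure_singleton_trans closure_singleton_sym assms by blast
qed

text \<open>Extend \<open>{y}\<close> inside \<open>insert y B\<close> to the size of
  \<open>B\<close>. The result must omit \<open>x\<close>, because \<open>{x, y}\<close> is
  dependent, and then its size leaves only \<open>B\<close> with \<open>x\<close> replaced by
  \<open>y\<close>.\<close>

lemma basis_parallel_exchange:
  assumes "loopless E indep" "matroid_basis indep B" "x \<in> B"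
    and y: "y \<in> matroid_closure E indep {x}" "y \<noteq> x"
  shows "y \<notin> B" "matroid_basis indep (insert y (B - {x}))"
proof -
  have B: "indep B" "card B = matroid_rank indep E" "finite B"
    using assms(2) indep_finite by (auto simp: basis_iff_card)
  have "x \<in> E" using B(1) assms(3) indep_subset_ground by blast
  then have "y \<in> E" and dep: "\<not> indep {x, y}"
    using in_closure_singleton_iff[OF assms(1), of x y] y by auto
  show yB: "y \<notin> B" using dep indep_subset[OF B(1), of "{x, y}"] assms(3) by auto
  have "card {y} \<le> card B" using B(3) assms(3) by (auto simp: Suc_le_eq card_gt_0_iff)
  then obtain Z where Z: "{y} \<subseteq> Z" "Z \<subseteq> {y} \<union> B" "indep Z" "card Z = card B"
    using indep_extend[of "{y}" B] indep_singleton[OF assms(1) \<open>y \<in> E\<close>] B(1) by blast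
  have "x \<notin> Z" using dep indep_subset[OF Z(3), of "{x, y}"] Z(1) by auto
  then have "Z \<subseteq> insert y (B - {x})" using Z(2) by auto
  moreover have card: "card (insert y (B - {x})) = card B"
    using B(3) yB assms(3) card_Suc_Diff1[of B x] by simp
  ultimately have "Z = insert y (B - {x})"
    using Z(4) B(3) by (intro card_seteq) auto
  then show "matroid_basis indep (insert y (B - {x}))"
    using Z(3) B(2) card by (simp add: basis_iff_card)
qed

section \<open>Weighted double counting of exchanges\<close>

definition parallel_moves :: "'a set \<Rightarrow> 'a set \<Rightarrow> nat \<Rightarrow> ('a set \<times> 'a \<times> 'a) set" where
  "parallel_moves R S k = (SIGMA B:{B. matroid_basis indep B \<and> card (B \<inter> R) = k}.
     SIGMA x:B \<inter> R. matroid_closure E indep {x} \<inter> S)"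

text \<open>The ratio hypothesis fixes only the proportion in which each class is divided. This
  weight turns the number of admissible partners of \<open>x\<close> into that proportion, which is
  the same for all classes.\<close>

abbreviation class_weight :: "'a \<Rightarrow> real" where
  "class_weight x \<equiv> 1 / real (card (matroid_closure E indep {x}))"

text \<open>Each counted basis offers \<open>k\<close> choices of \<open>x\<close>, and the partners
  of each \<open>x\<close> have total weight \<open>c\<close>.\<close>

lemma sum_parallel_moves:
  assumes "\<And>x. x \<in> E \<inter> R \<Longrightarrow>
    real (card (matroid_closure E indep {x} \<inter> S)) * class_weight x = c"
  shows "(\<Sum>(B, x, y)\<in>parallel_moves R S k. class_weight x) =
    real (num_bases indep R k) * real k * c"
proof -
  define \<B> where "\<B> = {B. matroid_basis indep B \<and> card (B \<inter> R) = k}"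
  have fin\<B>: "finite \<B>"
    unfolding \<B>_def by (rule finite_subset[OF _ finite_bases]) auto
  have sub: "B \<subseteq> E" if "B \<in> \<B>" for B
    using that indep_subset_ground by (auto simp: \<B>_def basis_iff_card)
  have finB: "finite B" if "B \<in> \<B>" for B
    using sub[OF that] finite_ground finite_subset by blast
  have fincl: "finite (matroid_closure E indep {x})" for x
    using finite_ground by (simp add: matroid_closure_def)
  have inner: "(\<Sum>y\<in>matroid_closure E indep {x} \<inter> S. class_weight x) = c"
    if "B \<in> \<B>" "x \<in> B \<inter> R" for B x
    using assms[of x] sub[OF that(1)] that(2) by auto
  have "(\<Sum>(B, x, y)\<in>parallel_moves R S k. class_weight x) =
    (\<Sum>B\<in>\<B>. \<Sum>(x, y)\<in>(SIGMA x:B \<inter> R. matroid_closure E indep {x} \<inter> S). class_weight x)"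
    unfolding parallel_moves_def \<B>_def[symmetric]
    by (subst sum.Sigma) (auto simp: fin\<B> finB fincl)
  also have "\<dots> = (\<Sum>B\<in>\<B>. \<Sum>x\<in>B \<inter> R. \<Sum>y\<in>matroid_closure E indep {x} \<inter> S. class_weight x)"
    by (intro sum.cong refl, subst sum.Sigma) (auto simp: finB fincl)
  also have "\<dots> = (\<Sum>B\<in>\<B>. \<Sum>x\<in>B \<inter> R. c)"
    by (intro sum.cong refl inner) auto
  also have "\<dots> = (\<Sum>B\<in>\<B>. real k * c)"
    by (intro sum.cong) (auto simp: \<B>_def)
  finally show ?thesis by (simp add: num_bases_def \<B>_def)
qed

text \<open>The old basis has \<open>matroid_rank indep E - k\<close> elements in \<open>T\<close>
  and the new one has one more, whence \<open>k + l\<close> exceeds the rank by one. The weight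
  survives because parallel elements have the same class.\<close>

lemma parallel_moves_swap:
  assumes "loopless E indep" "S \<inter> T = {}" "S \<union> T = E" "k + l = Suc (matroid_rank indep E)"
    and "(B, x, y) \<in> parallel_moves S T k"
  shows "(insert y (B - {x}), y, x) \<in> parallel_moves T S l"
    and "insert x (insert y (B - {x}) - {y}) = B"
    and "class_weight y = class_weight x"
proof -
  have B: "matroid_basis indep B" "card (B \<inter> S) = k" and x: "x \<in> B" "x \<in> S"
    and y: "y \<in> matroid_closure E indep {x}" "y \<in> T"
    using assms(5) by (auto simp: parallel_moves_def)
  have iB: "indep B" "card B = matroid_rank indep E" "finite B" "B \<subseteq> E"
    using B indep_finite indep_subset_ground by (auto simp: basis_iff_card)
  have "x \<in> E" using x assms(3) by blast
  have neq: "y \<noteq> x" using x y assms(2) by blast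
  note ex = basis_parallel_exchange[OF assms(1) B(1) x(1) y(1) neq]
  show "insert x (insert y (B - {x}) - {y}) = B" using ex(1) x(1) by auto
  show "class_weight y = class_weight x"
    using closure_singleton_eq[OF assms(1) \<open>x \<in> E\<close> y(1)] by simp
  have "card B = card (B \<inter> S) + card (B \<inter> T)"
    using iB assms(2,3) by (intro card_split) auto
  \<comment> \<open>The removed \<open>x\<close> lies in \<open>S\<close>, so the part in
    \<open>T\<close> only gains \<open>y\<close>, which is new to \<open>B\<close>.\<close>
  moreover have "insert y (B - {x}) \<inter> T = insert y (B \<inter> T)" using x y assms(2) by auto
  ultimately have "card (insert y (B - {x}) \<inter> T) = l"
    using ex(1) iB B(2) assms(4) by simp
  then show "(insert y (B - {x}), y, x) \<in> parallel_moves T S l"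
    using ex(2) x y closure_singleton_sym[OF assms(1) \<open>x \<in> E\<close> y(1)]
    by (auto simp: parallel_moves_def)
qed

text \<open>Exchanging back undoes an exchange, so the same map serves as its own inverse once
  \<open>S\<close> and \<open>T\<close> trade places.\<close>

lemma sum_parallel_moves_swap:
  assumes "loopless E indep" "S \<inter> T = {}" "S \<union> T = E" "k + l = Suc (matroid_rank indep E)"
  shows "(\<Sum>(B, x, y)\<in>parallel_moves S T k. class_weight x) =
    (\<Sum>(B, x, y)\<in>parallel_moves T S l. class_weight x)"
proof -
  have assms': "T \<inter> S = {}" "T \<union> S = E" "l + k = Suc (matroid_rank indep E)"
    using assms by auto
  note to = parallel_moves_swap[OF assms]
  note fro = parallel_moves_swap[OF assms(1) assms']
  let ?f = "\<lambda>(B, x, y). (insert y (B - {x}), y, x)"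
  show ?thesis
  proof (rule sum.reindex_bij_witness[of _ ?f ?f])
    fix a assume "a \<in> parallel_moves S T k"
    moreover obtain B x y where "a = (B, x, y)" using prod_cases3 .
    ultimately show "?f (?f a) = a" "?f a \<in> parallel_moves T S l"
      "(case ?f a of (B, x, y) \<Rightarrow> class_weight x) = (case a of (B, x, y) \<Rightarrow> class_weight x)"
      using to[of B x y] by simp_all
  next
    fix a assume "a \<in> parallel_moves T S l"
    moreover obtain B x y where "a = (B, x, y)" using prod_cases3 .
    ultimately show "?f (?f a) = a" "?f a \<in> parallel_moves S T k"
      using fro[of B x y] by simp_all
  qed
qed

section \<open>Recurrence for the basis counts\<close>

lemma num_bases_complement:
  assumes "k + l = matroid_rank indep E"
  shows "num_bases indep (E - R) l = num_bases indep R k"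
proof -
  have "card (B \<inter> (E - R)) = l \<longleftrightarrow> card (B \<inter> R) = k" if "matroid_basis indep B" for B
  proof -
    have B: "card B = matroid_rank indep E" "B \<subseteq> E" "finite B"
      using that indep_finite indep_subset_ground by (auto simp: basis_iff_card)
    have "card B = card (B \<inter> R) + card (B \<inter> (E - R))"
      using B by (intro card_split) auto
    then show ?thesis using B assms by auto
  qed
  then have "{B. matroid_basis indep B \<and> card (B \<inter> (E - R)) = l} =
      {B. matroid_basis indep B \<and> card (B \<inter> R) = k}" by blast
  then show ?thesis by (simp add: num_bases_def)
qed

text \<open>After division by \<open>r + q\<close>, the two sides are the total weights of the
  exchanges from \<open>R\<close> to \<open>E - R\<close> and of their reversals.\<close>

lemma num_bases_recurrence:
  assumes "loopless E indep" "R \<subseteq> E" "r \<ge> 1" "k < matroid_rank indep E"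
    and ratio: "\<And>x. x \<in> E \<Longrightarrow> card (matroid_closure E indep {x} \<inter> R) * r =
      card (matroid_closure E indep {x} \<inter> (E - R)) * q"
  shows "real (num_bases indep R (Suc k)) * real (Suc k) * real r =
    real (num_bases indep R k) * real (matroid_rank indep E - k) * real q"
proof -
  let ?Q = "E - R" and ?l = "matroid_rank indep E - k"
  \<comment> \<open>For a class \<open>C\<close>, adding
    \<open>card (C \<inter> (E - R)) * r\<close> to both sides of the ratio condition gives
    \<open>card C * r = card (C \<inter> (E - R)) * (r + q)\<close>; the part in \<open>R\<close> is
    symmetric.\<close>
  have fraction: "real (card (matroid_closure E indep {x} \<inter> ?Q)) * class_weight x = real r / real (r + q)"
    "real (card (matroid_closure E indep {x} \<inter> R)) * class_weight x = real q / real (r + q)"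
    if x: "x \<in> E" for x
  proof -
    let ?C = "matroid_closure E indep {x}"
    have C: "?C \<subseteq> E" "finite ?C" using finite_ground by (auto simp: matroid_closure_def)
    have eq: "card ?C = card (?C \<inter> R) + card (?C \<inter> ?Q)"
      using C by (intro card_split) auto
    have pos: "card ?C > 0" using C closure_singleton_refl[OF x] by (auto simp: card_gt_0_iff)
    have "real (card (?C \<inter> R)) * r = real (card (?C \<inter> ?Q)) * q"
      using ratio[OF x] by (metis of_nat_mult)
    then show "real (card (?C \<inter> ?Q)) * class_weight x = real r / real (r + q)"
      "real (card (?C \<inter> R)) * class_weight x = real q / real (r + q)"
      using pos assms(3) eq by (auto simp: field_simps)
  qed
  have "real (num_bases indep R (Suc k)) * real (Suc k) * (real r / real (r + q)) =
      (\<Sum>(B, x, y)\<in>parallel_moves R ?Q (Suc k). class_weight x)"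
    using fraction by (intro sum_parallel_moves[symmetric]) auto
  \<comment> \<open>A basis with \<open>Suc k\<close> elements in \<open>R\<close> has
    \<open>?l - 1\<close> in \<open>?Q\<close>, hence \<open>?l\<close> after the exchange.\<close>
  also have "\<dots> = (\<Sum>(B, x, y)\<in>parallel_moves ?Q R ?l. class_weight x)"
    using assms by (intro sum_parallel_moves_swap) auto
  also have "\<dots> = real (num_bases indep ?Q ?l) * real ?l * (real q / real (r + q))"
    using fraction by (intro sum_parallel_moves) auto
  also have "num_bases indep ?Q ?l = num_bases indep R k"
    using assms by (intro num_bases_complement) auto
  finally show ?thesis using assms(3) by (simp add: field_simps)
qed

end

theorem theorem3p3p10:
  fixes E R Q :: "'a set" and indep :: "'a set \<Rightarrow> bool" and n r q :: nat
  assumes "matroid E indep"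
    and "loopless E indep"
    and "matroid_rank indep E = n"
    and "R \<subseteq> E"
    and "Q = E - R"
    and "r \<ge> 1" and "q \<ge> 1"
    and "\<forall>x\<in>E. card (matroid_closure E indep {x} \<inter> R) * r
              = card (matroid_closure E indep {x} \<inter> Q) * q"
  shows "(\<forall>k\<in>{1..n - 1}. (norm_num_bases E indep R k)\<^sup>2
            = norm_num_bases E indep R (k - 1) * norm_num_bases E indep R (k + 1))
       \<and> (\<forall>k\<in>{1..n}. norm_num_bases E indep R k
            = real q / real r * norm_num_bases E indep R (k - 1))"
proof -
  interpret matroid E indep by fact
  \<comment> \<open>The binomial normalization absorbs the factors \<open>Suc k\<close> and
    \<open>n - k\<close> of the recurrence and leaves a ratio independent of \<open>k\<close>. Both
    claims follow from this.\<close>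
  have step: "norm_num_bases E indep R (Suc k) = real q / real r * norm_num_bases E indep R k"
    if "k < n" for k
  proof -
    have rec: "real (num_bases indep R (Suc k)) * real (Suc k) * real r =
        real (num_bases indep R k) * real (n - k) * real q"
      using num_bases_recurrence[where R = R and r = r and q = q and k = k] assms that by simp
    \<comment> \<open>Both sides equal \<open>n * ((n - 1) choose k)\<close>.\<close>
    have "Suc k * (n choose Suc k) = (n - k) * (n choose k)"
      by (simp only: binomial_absorption binomial_absorb_comp)
    then have bin: "real (Suc k) * real (n choose Suc k) = real (n - k) * real (n choose k)"
      by (metis of_nat_mult)
    have pos: "real (n choose Suc k) > 0" "real (n choose k) > 0" "real (n - k) > 0" "real r > 0"
      using that assms(6) by auto
    \<comment> \<open>The extra factor \<open>n - k\<close> allows \<open>bin\<close> to produce the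
      left side of \<open>rec\<close>; it is positive for \<open>k < n\<close> and cancels
      afterwards.\<close>
    have "real (num_bases indep R (Suc k)) * real r * real (n choose k) * real (n - k) =
        real (num_bases indep R (Suc k)) * real (Suc k) * real r * real (n choose Suc k)"
      using bin by (simp add: ac_simps)
    also have "\<dots> = real (num_bases indep R k) * real q * real (n choose Suc k) * real (n - k)"
      by (subst rec) (simp add: ac_simps)
    finally have "real (num_bases indep R (Suc k)) * real r * real (n choose k) =
        real (num_bases indep R k) * real q * real (n choose Suc k)"
      using pos(3) by simp
    then show ?thesis
      using pos by (simp add: norm_num_bases_def assms(3) field_simps)
  qed
  show ?thesis
  proof (intro conjI ballI)
    fix k assume "k \<in> {1..n - 1}"
    \<comment> \<open>Two consecutive steps, from \<open>j\<close> and from \<open>Suc j\<close>,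
      turn both sides into \<open>(q / r)^2\<close> times the square of the normalized count at
      \<open>j\<close>.\<close>
    then obtain j where "k = Suc j" "Suc j < n" by (cases k) auto
    then show "(norm_num_bases E indep R k)\<^sup>2 =
        norm_num_bases E indep R (k - 1) * norm_num_bases E indep R (k + 1)"
      using step[of j] step[of "Suc j"] by (simp add: power2_eq_square)
  next
    fix k assume "k \<in> {1..n}"
    then show "norm_num_bases E indep R k =
        real q / real r * norm_num_bases E indep R (k - 1)"
      using step[of "k - 1"] by auto
  qed
qed

end
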